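(* Let $a,b,c$ be complex numbers with $c\notin\{0,-1,-2,\dots\}$. Suppose that the hypergeometric function $F(z)={}_2F_1(a,b;c;z)$ belongs to the class $\mathcal T$. Then either $a,b,c\in\mathbb R$, or else $F(z)=(1-z)^{-k}$ for some constant $k$ with $0\le k\le 1$.
   Context: Let $\Lambda=\mathbb C\setminus[1,+\infty)=\{z\neq 1:|\arg(1-z)|<\pi\}$. The class $\mathcal T$ is the set of analytic functions $F$ on $\Lambda$ for which there is a Borel probability measure $\mu$ on $[0,1]$ with $F(z)=\int_0^1\frac{d\mu(t)}{1-tz}$ for all $z\in\Lambda$. For complex parameters $a,b,c$ with $c\notin\{0,-1,-2,\dots\}$, ${}_2F_1(a,b;c;z)=\sum_{n=0}^\infty\frac{(a)_n(b)_n}{(c)_n\,n!}z^n$ for $|z|<1$, where $(a)_0=1$ and $(a)_n=a(a+1)\cdots(a+n-1)$ for $n\ge1$; on $\Lambda$ it denotes the (single-valued) analytic continuation of this series. Powers of $1-z$ on $\Lambda$ are principal branches. *)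

theory Defs
  imports "HOL-Complex_Analysis.Complex_Analysis" "HOL-Probability.Probability"
begin

definition slit_plane :: "complex set" where
  "slit_plane = UNIV - complex_of_real ` {1..}"

text \<open>Borel measures on \<open>[0,1]\<close> are measures whose underlying space is \<open>[0,1]\<close> itself.
  The integrand is bounded and continuous on \<open>[0,1]\<close> for every \<open>z\<close> in the slit plane, so the
  Bochner integral always takes its proper value. Only values on the slit plane matter.\<close>

definition class_T :: "(complex \<Rightarrow> complex) set" where
  "class_T = {F. F analytic_on slit_plane \<and>
     (\<exists>\<mu> :: real measure. sets \<mu> = sets (restrict_space borel {0..1}) \<and> prob_space \<mu> \<and>
        (\<forall>z\<in>slit_plane. F z = (LINT t|\<mu>. 1 / (1 - complex_of_real t * z))))}"

text \<open>\<open>is_hyp2F1 a b c F\<close>: on the slit plane, \<open>F\<close> is the single-valued analytic continuation of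
  the Gauss series. It is determined there by \<open>a\<close>, \<open>b\<close>, \<open>c\<close> (\<open>is_hyp2F1_unique\<close>); its values on
  the cut are unconstrained.\<close>

definition is_hyp2F1 :: "complex \<Rightarrow> complex \<Rightarrow> complex \<Rightarrow> (complex \<Rightarrow> complex) \<Rightarrow> bool" where
  "is_hyp2F1 a b c F \<longleftrightarrow> F analytic_on slit_plane \<and>
     (\<forall>z. norm z < 1 \<longrightarrow>
        (\<lambda>n. pochhammer a n * pochhammer b n / (pochhammer c n * fact n) * z ^ n) sums F z)"

lemma open_slit_plane: "open slit_plane"
proof -
  have "closed (complex_of_real ` {1..})"
    by (intro closed_injective_linear_image) (auto intro!: linearI simp: inj_on_def scaleR_conv_of_real)
  then show ?thesis
    by (simp add: slit_plane_def open_Diff)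
qed

lemma ball_subset_slit_plane: "ball 0 1 \<subseteq> slit_plane"
  by (auto simp: slit_plane_def)

lemma starlike_slit_plane: "starlike slit_plane"
  unfolding starlike_def
proof (intro bexI ballI subsetI)
  show "0 \<in> slit_plane" by (auto simp: slit_plane_def)
  fix z w :: complex
  assume z: "z \<in> slit_plane" and "w \<in> closed_segment 0 z"
  then obtain u where u: "0 \<le> u" "u \<le> 1" "w = of_real u * z"
    by (auto simp: closed_segment_def scaleR_conv_of_real)
  show "w \<in> slit_plane"
  proof (rule ccontr)
    assume "w \<notin> slit_plane"
    then obtain x :: real where x: "x \<ge> 1" "of_real u * z = of_real x"
      using u by (auto simp: slit_plane_def)
    then have "u > 0" using u by (cases "u = 0") auto
    then have "z = complex_of_real (x / u)" "x / u \<in> {1..}"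
      using x u by (auto simp: field_simps)
    then show False using z unfolding slit_plane_def by blast
  qed
qed

lemma is_hyp2F1_unique:
  assumes "is_hyp2F1 a b c F" "is_hyp2F1 a b c G" "z \<in> slit_plane"
  shows "F z = G z"
proof (rule analytic_continuation_open[of "ball 0 1" slit_plane F G])
  show "F w = G w" if "w \<in> ball 0 1" for w
    using that assms(1,2) by (auto simp: is_hyp2F1_def intro: sums_unique2)
qed (use assms open_slit_plane ball_subset_slit_plane
      starlike_imp_connected[OF starlike_slit_plane] in
     \<open>auto simp: is_hyp2F1_def analytic_imp_holomorphic\<close>)

end

theory Submission
  imports Defs
begin

text \<open>The Taylor coefficients of \<open>F\<close> are the moments of \<open>\<mu>\<close>. If one of them vanishes, \<open>\<mu>\<close> is the
  point mass at \<open>0\<close> and \<open>F = 1\<close>. Otherwise their consecutive ratios are real, so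
  \<open>(n + a) (n + b) (n + cnj c)\<close> is real for all \<open>n\<close>, that is, \<open>(z + a) (z + b) (z + cnj c)\<close> is a real
  polynomial. For nonreal \<open>c\<close> its real symmetry forces \<open>c = a\<close> or \<open>c = b\<close>, and \<open>F\<close> is a power of
  \<open>1 - z\<close>, with exponent given by the first moment. For real \<open>c\<close>, either \<open>a\<close> and \<open>b\<close> are real or
  \<open>b = cnj a\<close> is not real. In the last case the hypergeometric equation is oscillatory along the
  negative axis near infinity, which is impossible since \<open>F(-x)\<close> is positive, decreasing in \<open>x\<close>, and
  \<open>x F(-x)\<close> is increasing.\<close>

section \<open>Moments and Stieltjes integrals of probability measures on [0,1]\<close>

locale stieltjes_prob = prob_space \<mu> for \<mu> :: "real measure" +
  assumes sets_eq: "sets \<mu> = sets (restrict_space borel {0..1})"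
begin

lemma space_eq: "space \<mu> = {0..1}"
  using sets_eq_imp_space_eq[OF sets_eq] by (simp add: space_restrict_space)

lemma borel_measurable_continuous_on:
  fixes f :: "real \<Rightarrow> 'b :: topological_space"
  assumes "continuous_on {0..1} f"
  shows "f \<in> borel_measurable \<mu>"
  using borel_measurable_continuous_on_restrict[OF assms]
  by (simp add: measurable_cong_sets[OF sets_eq refl])

lemma integrable_continuous_on:
  fixes f :: "real \<Rightarrow> 'b :: {banach, second_countable_topology}"
  assumes "continuous_on {0..1} f"
  shows "integrable \<mu> f"
proof -
  have "compact (f ` {0..1})"
    by (intro compact_continuous_image assms) auto
  then obtain B where "\<And>t. t \<in> {0..1} \<Longrightarrow> norm (f t) \<le> B"
    using compact_imp_bounded bounded_iff by (metis imageI)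
  then show ?thesis
    by (intro integrable_const_bound[where B = B] borel_measurable_continuous_on assms AE_I2)
       (auto simp: space_eq)
qed

definition moment :: "nat \<Rightarrow> real" where
  "moment n = (LINT t|\<mu>. t ^ n)"

lemma integrable_power: "integrable \<mu> (\<lambda>t. t ^ n)"
  by (intro integrable_continuous_on continuous_intros)

lemma moment_nonneg: "0 \<le> moment n"
  unfolding moment_def by (rule integral_nonneg_AE) (auto simp: space_eq)

lemma moment_le_1: "moment n \<le> 1"
proof -
  have "moment n \<le> (LINT t|\<mu>. 1)"
    unfolding moment_def
    by (intro integral_mono integrable_power) (auto simp: space_eq power_le_one)
  then show ?thesis by (simp add: prob_space)
qed

text \<open>A nonnegative integrand with integral 0 vanishes almost everywhere. For
  \<open>n = 0\<close> the claim is vacuous, since \<open>t ^ 0 = 1\<close>.\<close>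

lemma moment_eq_0_imp_AE:
  assumes "moment n = 0"
  shows "AE t in \<mu>. t = 0"
proof -
  have "AE t in \<mu>. t ^ n = 0"
    using assms
    by (subst integral_nonneg_eq_0_iff_AE[symmetric, OF integrable_power])
       (auto simp: moment_def space_eq intro!: AE_I2)
  then show ?thesis by (rule AE_mp) auto
qed

text \<open>The geometric series is integrated term by term; since moments are at most 1, the norms
  of its terms have integrals bounded by \<open>norm z ^ n\<close>.\<close>

lemma moment_sums:
  assumes z: "norm (z :: complex) < 1"
  shows "(\<lambda>n. of_real (moment n) * z ^ n) sums (LINT t|\<mu>. 1 / (1 - of_real t * z))"
proof -
  let ?f = "\<lambda>n t. complex_of_real (t ^ n) * z ^ n"
  have int: "integrable \<mu> (?f n)" for n
    by (intro integrable_continuous_on continuous_intros)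
  have tz: "norm (of_real t * z) < 1" if "t \<in> {0..1}" for t
    using that z mult_left_le_one_le[of "norm z" t] by (auto simp: norm_mult)
  have ge: "?f n t = (of_real t * z) ^ n" for n t
    by (simp add: power_mult_distrib)
  have "(\<lambda>n. integral\<^sup>L \<mu> (?f n)) sums (LINT t|\<mu>. (\<Sum>n. ?f n t))"
  proof (rule sums_integral[OF int])
    show "AE t in \<mu>. summable (\<lambda>n. norm (?f n t))"
      unfolding ge norm_power by (intro AE_I2 summable_geometric) (use tz space_eq in auto)
    have "norm (LINT t|\<mu>. norm (?f n t)) \<le> norm z ^ n" for n
    proof -
      have "(LINT t|\<mu>. norm (?f n t)) = moment n * norm z ^ n"
        unfolding moment_def integral_mult_left_zero[symmetric]
        by (intro Bochner_Integration.integral_cong) (auto simp: norm_mult norm_power space_eq)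
      then show ?thesis
        using moment_nonneg[of n] moment_le_1[of n] by (simp add: mult_left_le_one_le abs_mult)
    qed
    then show "summable (\<lambda>n. LINT t|\<mu>. norm (?f n t))"
      by (intro summable_comparison_test'[OF summable_geometric]) (use z in auto)
  qed
  moreover have "integral\<^sup>L \<mu> (?f n) = of_real (moment n) * z ^ n" for n
    unfolding moment_def integral_complex_of_real[symmetric] by (rule integral_mult_left_zero)
  moreover have "(LINT t|\<mu>. (\<Sum>n. ?f n t)) = (LINT t|\<mu>. 1 / (1 - of_real t * z))"
    unfolding ge by (intro Bochner_Integration.integral_cong) (use tz space_eq in \<open>auto simp: suminf_geometric\<close>)
  ultimately show ?thesis by (simp only:)
qed

definition stieltjes :: "real \<Rightarrow> real" where
  "stieltjes x = (LINT t|\<mu>. 1 / (1 + t * x))"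

lemma one_plus_mult_pos: "t \<in> {0..1} \<Longrightarrow> 0 \<le> x \<Longrightarrow> 0 < 1 + t * (x :: real)"
  by (simp add: add_pos_nonneg)

lemma integrable_stieltjes: "0 \<le> x \<Longrightarrow> integrable \<mu> (\<lambda>t. 1 / (1 + t * x))"
  using one_plus_mult_pos by (intro integrable_continuous_on continuous_intros) fastforce

text \<open>On [0,1] the integrand is at least the positive constant \<open>1 / (1 + x)\<close>, and
  the total mass is 1.\<close>

lemma stieltjes_pos:
  assumes "0 \<le> x"
  shows "0 < stieltjes x"
proof -
  have "(LINT t|\<mu>. 1 / (1 + x)) \<le> stieltjes x"
    unfolding stieltjes_def
    by (intro integral_mono integrable_stieltjes assms)
       (use assms mult_right_mono[of _ 1 x] in \<open>auto simp: space_eq intro!: divide_left_mono mult_pos_pos one_plus_mult_pos\<close>)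
  then have "1 / (1 + x) \<le> stieltjes x"
    by (simp add: prob_space)
  moreover have "0 < 1 / (1 + x)"
    using assms by simp
  ultimately show ?thesis by linarith
qed

lemma stieltjes_antimono:
  assumes "0 \<le> x" "x \<le> y"
  shows "stieltjes y \<le> stieltjes x"
  unfolding stieltjes_def
  by (intro integral_mono integrable_stieltjes)
     (use assms in \<open>auto simp: space_eq intro!: divide_left_mono mult_pos_pos one_plus_mult_pos mult_left_mono\<close>)

text \<open>For each \<open>t\<close> in [0,1], \<open>x / (1 + t * x)\<close> increases with
  \<open>x\<close>. This later bounds the logarithmic derivative from below.\<close>

lemma mult_stieltjes_mono:
  assumes "0 \<le> x" "x \<le> y"
  shows "x * stieltjes x \<le> y * stieltjes y"
  unfolding stieltjes_def integral_mult_right_zero[symmetric]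
proof (intro integral_mono integrable_mult_right integrable_stieltjes)
  fix t assume "t \<in> space \<mu>"
  then have t: "0 < 1 + t * x" "0 < 1 + t * y"
    using assms by (auto simp: space_eq intro!: one_plus_mult_pos)
  show "x * (1 / (1 + t * x)) \<le> y * (1 / (1 + t * y))"
    using t assms by (simp add: field_simps)
qed (use assms in auto)

lemma LINT_eq_stieltjes:
  "(LINT t|\<mu>. 1 / (1 - complex_of_real t * complex_of_real (- x))) = of_real (stieltjes x)"
  unfolding stieltjes_def integral_complex_of_real[symmetric]
  by (intro Bochner_Integration.integral_cong) auto

end

lemma slit_plane_denominator_nonzero:
  assumes "z \<in> slit_plane" "t \<in> {0..1}"
  shows "1 - complex_of_real t * z \<noteq> 0"
proof
  assume "1 - complex_of_real t * z = 0"
  then have "z = complex_of_real (1 / t)" "t \<noteq> 0"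
    by (auto simp: divide_simps mult.commute)
  moreover from this have "1 / t \<in> {1..}"
    using assms(2) by auto
  ultimately show False
    using assms(1) unfolding slit_plane_def by blast
qed

lemma class_TE:
  assumes "F \<in> class_T"
  obtains \<mu> where "stieltjes_prob \<mu>"
    "\<And>z. z \<in> slit_plane \<Longrightarrow> F z = (LINT t|\<mu>. 1 / (1 - complex_of_real t * z))"
  using assms unfolding class_T_def stieltjes_prob_def stieltjes_prob_axioms_def by blast

section \<open>Taylor coefficients and reality of the parameters\<close>

lemma fps_expansion_sums_unique:
  fixes f g :: "nat \<Rightarrow> complex"
  assumes "\<And>z. norm z < 1 \<Longrightarrow> (\<lambda>n. f n * z ^ n) sums h z"
      and "\<And>z. norm z < 1 \<Longrightarrow> (\<lambda>n. g n * z ^ n) sums h z"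
  shows "f = g"
proof
  fix n
  have ev: "eventually (\<lambda>z::complex. norm z < 1) (nhds 0)"
    using eventually_nhds_in_open[of "ball 0 1" "0 :: complex"] by simp
  have "h has_fps_expansion Abs_fps f" "h has_fps_expansion Abs_fps g"
    by (intro has_fps_expansionI eventually_mono[OF ev]; use assms in simp)+
  then show "f n = g n"
    by (metis fps_nth_fps_expansion fps_nth_Abs_fps)
qed

definition hyp_coeff :: "complex \<Rightarrow> complex \<Rightarrow> complex \<Rightarrow> nat \<Rightarrow> complex" where
  "hyp_coeff a b c n = pochhammer a n * pochhammer b n / (pochhammer c n * fact n)"

text \<open>The ratio of consecutive coefficients, cross-multiplied so that it stays valid when
  coefficients vanish.\<close>

lemma hyp_coeff_Suc:
  assumes "c \<notin> \<int>\<^sub>\<le>\<^sub>0"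
  shows "of_nat (Suc n) * (c + of_nat n) * hyp_coeff a b c (Suc n) =
    (a + of_nat n) * (b + of_nat n) * hyp_coeff a b c n"
proof -
  have "c + of_nat n \<noteq> 0" "pochhammer c n \<noteq> 0"
    using assms by (auto simp: pochhammer_eq_0_iff add_eq_0_iff2)
  moreover have "(1 + of_nat n :: complex) \<noteq> 0"
    by (metis of_nat_Suc of_nat_neq_0)
  ultimately show ?thesis
    by (simp add: hyp_coeff_def pochhammer_Suc divide_simps)
qed

text \<open>The quotient of \<open>(a + n) (b + n)\<close> by \<open>c + n\<close> is real;
  multiplying it by the squared modulus of \<open>c + n\<close> trades the denominator for the
  factor \<open>cnj c + n\<close>.\<close>

lemma hyp_coeff_real_imp:
  assumes "c \<notin> \<int>\<^sub>\<le>\<^sub>0" "hyp_coeff a b c n \<noteq> 0"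
    and "hyp_coeff a b c n \<in> \<real>" "hyp_coeff a b c (Suc n) \<in> \<real>"
  shows "(a + of_nat n) * (b + of_nat n) * (cnj c + of_nat n) \<in> \<real>"
proof -
  define r where "r = of_nat (Suc n) * hyp_coeff a b c (Suc n) / hyp_coeff a b c n"
  have r: "r \<in> \<real>"
    using assms by (auto simp: r_def simp del: of_nat_Suc)
  have "(a + of_nat n) * (b + of_nat n) = (c + of_nat n) * r"
    using hyp_coeff_Suc[OF assms(1), of n a b] assms(2) by (simp add: r_def field_simps)
  then have "(a + of_nat n) * (b + of_nat n) * (cnj c + of_nat n) =
      r * ((c + of_nat n) * cnj (c + of_nat n))"
    by simp
  also have "\<dots> \<in> \<real>"
    unfolding complex_mult_cnj by (intro Reals_mult r Reals_of_real)
  finally show ?thesis .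
qed

text \<open>The cubic term is real, so the imaginary part is a polynomial in \<open>n\<close> of
  degree at most 2; its zeros at 0, 1 and 2 make it vanish.\<close>

lemma cubic_real_imp_coeffs_real:
  fixes a b d :: complex
  assumes "\<And>n :: nat. (a + of_nat n) * (b + of_nat n) * (d + of_nat n) \<in> \<real>"
  shows "a + b + d \<in> \<real>" "a * b + a * d + b * d \<in> \<real>" "a * b * d \<in> \<real>"
proof -
  have eq: "(a + of_nat n) * (b + of_nat n) * (d + of_nat n) =
      a * b * d + of_nat n * (a * b + a * d + b * d) + of_nat (n ^ 2) * (a + b + d) + of_nat (n ^ 3)" for n
    by (simp add: algebra_simps power2_eq_square power3_eq_cube)
  have im: "Im (a * b * d) + of_nat n * Im (a * b + a * d + b * d) + of_nat (n ^ 2) * Im (a + b + d) = 0" for n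
  proof -
    have "Im (of_nat k * z) = of_nat k * Im z" for k z
      by simp
    then show ?thesis
      using assms[of n] unfolding eq complex_is_Real_iff by (simp del: of_nat_power)
  qed
  show "a + b + d \<in> \<real>" "a * b + a * d + b * d \<in> \<real>" "a * b * d \<in> \<real>"
    using im[of 0] im[of 1] im[of 2] unfolding complex_is_Real_iff by (simp_all del: plus_complex.sel times_complex.sel)
qed

text \<open>The hypotheses say that \<open>(z + a) (z + b) (z + cnj c)\<close> is a real polynomial. It vanishes at
  \<open>- cnj c\<close>, hence also at \<open>- c\<close>.\<close>

lemma real_cubic_nonreal_root:
  fixes a b c :: complex
  assumes "a + b + cnj c \<in> \<real>" "a * b + a * cnj c + b * cnj c \<in> \<real>" "a * b * cnj c \<in> \<real>"
    and "c \<notin> \<real>"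
  shows "c = a \<or> c = b"
proof -
  obtain e1 e2 e3 where e: "a + b + cnj c = of_real e1"
      "a * b + a * cnj c + b * cnj c = of_real e2" "a * b * cnj c = of_real e3"
    using assms(1-3) by (auto elim!: Reals_cases)
  define P where "P z = z ^ 3 + of_real e1 * z ^ 2 + of_real e2 * z + of_real e3" for z :: complex
  have P: "P z = (z + a) * (z + b) * (z + cnj c)" for z
    unfolding P_def e[symmetric] by (simp add: algebra_simps power2_eq_square power3_eq_cube)
  have "P (- c) = cnj (P (- cnj c))"
    by (simp add: P_def)
  also have "\<dots> = 0"
    by (simp add: P)
  finally show ?thesis
    using assms(4) by (auto simp: P Reals_cnj_iff add_eq_0_iff2)
qed

text \<open>The hypotheses force \<open>b = cnj a\<close>, and the difference of the two sides is
  then four times the square of \<open>Im a\<close>.\<close>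

lemma conjugate_pair_discriminant:
  fixes a b :: complex
  assumes "a + b \<in> \<real>" "a * b \<in> \<real>" "a \<notin> \<real>"
  shows "(Re (a + b))\<^sup>2 < 4 * Re (a * b)"
proof -
  have b: "Im b = - Im a"
    using assms(1) by (simp add: complex_is_Real_iff)
  have "Im a * (Re b - Re a) = 0"
    using assms(2) by (simp add: complex_is_Real_iff b algebra_simps)
  then have "Re b = Re a"
    using assms(3) by (simp add: complex_is_Real_iff)
  moreover have "Im a * Im a > 0"
    using assms(3) by (simp add: complex_is_Real_iff zero_less_mult_iff) linarith
  ultimately show ?thesis
    by (simp add: b power2_eq_square algebra_simps)
qed

section \<open>The binomial case, the hypergeometric equation and its oscillation\<close>

lemma is_hyp2F1_commute: "is_hyp2F1 a b c F \<longleftrightarrow> is_hyp2F1 b a c F"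
  by (simp add: is_hyp2F1_def mult.commute)

text \<open>The equal parameters cancel, which leaves the binomial series.\<close>

lemma is_hyp2F1_powr:
  assumes "b \<notin> \<int>\<^sub>\<le>\<^sub>0"
  shows "is_hyp2F1 a b b (\<lambda>z. (1 - z) powr (- a))"
  unfolding is_hyp2F1_def
proof (intro conjI allI impI)
  have "1 - z \<notin> \<real>\<^sub>\<le>\<^sub>0" if "z \<in> slit_plane" for z
  proof
    assume "1 - z \<in> \<real>\<^sub>\<le>\<^sub>0"
    then obtain r where "r \<le> 0" "1 - z = of_real r"
      by (auto elim: nonpos_Reals_cases)
    then have "z = of_real (1 - r)" "1 - r \<in> {1..}"
      by (auto simp: algebra_simps)
    with that show False unfolding slit_plane_def by blast
  qed
  then show "(\<lambda>z. (1 - z) powr (- a)) analytic_on slit_plane"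
    by (intro analytic_intros) auto
  fix z :: complex assume "norm z < 1"
  then have "(\<lambda>n. ((- a) gchoose n) * (- z) ^ n) sums (1 + - z) powr (- a)"
    by (intro gen_binomial_complex) simp
  moreover have "((- a) gchoose n) * (- z) ^ n =
      pochhammer a n * pochhammer b n / (pochhammer b n * fact n) * z ^ n" for n
  proof -
    have "pochhammer b n \<noteq> 0"
      using assms by (auto simp: pochhammer_eq_0_iff)
    moreover have "(- z) ^ n = (- 1) ^ n * z ^ n"
      by (rule power_minus)
    ultimately show ?thesis
      by (simp add: gbinomial_pochhammer power_mult_distrib[symmetric] flip: mult.assoc)
  qed
  ultimately show "(\<lambda>n. pochhammer a n * pochhammer b n / (pochhammer b n * fact n) * z ^ n) sums (1 - z) powr (- a)"
    by simp
qed

text \<open>The coefficient recurrence gives the equation near 0, and the identity theorem carries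
  it to the whole slit plane.\<close>

lemma hypergeometric_ode:
  assumes c: "c \<notin> \<int>\<^sub>\<le>\<^sub>0" and F: "is_hyp2F1 a b c F" and z: "z \<in> slit_plane"
  shows "z * (1 - z) * deriv (deriv F) z + (c - (a + b + 1) * z) * deriv F z - a * b * F z = 0"
proof -
  define L where "L z = z * (1 - z) * deriv (deriv F) z + (c - (a + b + 1) * z) * deriv F z - a * b * F z" for z
  define f where "f = Abs_fps (hyp_coeff a b c)"
  have hol: "F holomorphic_on slit_plane"
    using F by (simp add: is_hyp2F1_def analytic_imp_holomorphic)
  have "eventually (\<lambda>z::complex. norm z < 1) (nhds 0)"
    using eventually_nhds_in_open[of "ball 0 1" "0 :: complex"] by simp
  then have "F has_fps_expansion f"
    unfolding f_def
    by (intro has_fps_expansionI) (use F in \<open>auto elim!: eventually_mono simp: is_hyp2F1_def hyp_coeff_def\<close>)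
  then have "L has_fps_expansion fps_X * (1 - fps_X) * fps_deriv (fps_deriv f) +
      (fps_const c - fps_const (a + b + 1) * fps_X) * fps_deriv f - fps_const (a * b) * f"
    unfolding L_def by (intro fps_expansion_intros)
  also have "\<dots> = 0"
  proof (rule fps_ext)
    fix n
    show "fps_nth (fps_X * (1 - fps_X) * fps_deriv (fps_deriv f) +
      (fps_const c - fps_const (a + b + 1) * fps_X) * fps_deriv f - fps_const (a * b) * f) n = fps_nth 0 n"
      using hyp_coeff_Suc[OF c, of n a b]
      \<comment> \<open>Multiplication by \<open>fps_X\<close> shifts indices by up to two places,
        so 0 and 1 are treated separately.\<close>
      by (cases n; cases "n - 1")
         (simp_all add: f_def algebra_simps fps_X_mult_nth)
  qed
  finally obtain U where U: "open U" "0 \<in> U" "\<And>w. w \<in> U \<Longrightarrow> L w = 0"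
    by (auto simp: has_fps_expansion_def eventually_nhds)
  \<comment> \<open>\<open>U\<close> may leave the slit plane, hence the intersection with the unit
    disc.\<close>
  have "L z = 0"
  proof (rule analytic_continuation_open[of "U \<inter> ball 0 1" slit_plane L "\<lambda>_. 0"])
    show "L holomorphic_on slit_plane"
      unfolding L_def by (intro holomorphic_intros hol open_slit_plane)
  qed (use U z open_slit_plane ball_subset_slit_plane starlike_imp_connected[OF starlike_slit_plane] in auto)
  then show ?thesis by (simp add: L_def)
qed

text \<open>In the variable \<open>ln x\<close> the equation tends, as \<open>x\<close> grows, to \<open>h'' + s h' + p h = 0\<close>, whose
  characteristic roots are not real. For a positive solution, \<open>u = x h' / h\<close> satisfies the Riccati
  equation \<open>x u' = - (u\<^sup>2 + s u + p) + O(1 / x)\<close>, so \<open>u\<close> decreases at least like a multiple of \<open>- ln x\<close>,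
  although the last two hypotheses confine it to \<open>[-1, 0]\<close>.\<close>

lemma hypergeometric_ode_oscillates:
  fixes h h' h'' :: "real \<Rightarrow> real"
  assumes h: "\<And>x. 0 < x \<Longrightarrow> (h has_real_derivative h' x) (at x)"
    and h': "\<And>x. 0 < x \<Longrightarrow> (h' has_real_derivative h'' x) (at x)"
    and ode: "\<And>x. 0 < x \<Longrightarrow> x * (1 + x) * h'' x + (c + (s + 1) * x) * h' x + p * h x = 0"
    and disc: "s\<^sup>2 < 4 * p"
    and pos: "\<And>x. 0 < x \<Longrightarrow> 0 < h x"
    and nonpos: "\<And>x. 0 < x \<Longrightarrow> h' x \<le> 0"
    and lower: "\<And>x. 0 < x \<Longrightarrow> - h x \<le> x * h' x"
  shows False
proof -
  define u where "u x = x * h' x / h x" for x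
  \<comment> \<open>The minimum of the quadratic \<open>u^2 + s u + p\<close>, attained at
    \<open>u = - s / 2\<close>.\<close>
  define d where "d = p - s\<^sup>2 / 4"
  \<comment> \<open>\<open>K\<close> bounds the numerator of the error term \<open>R\<close> when
    \<open>u\<close> is in [-1,0]; \<open>X\<close> is chosen so that \<open>R\<close> is at most
    \<open>d / 2\<close> beyond it.\<close>
  define K where "K = \<bar>s + 1 - c\<bar> + \<bar>p\<bar>"
  define X where "X = 1 + 2 * K / d"
  have d: "d > 0" using disc by (simp add: d_def)
  have X: "X \<ge> 1" using d by (simp add: X_def K_def)
  have u: "-1 \<le> u x" "u x \<le> 0" if "0 < x" for x
    using pos[OF that] nonpos[OF that] lower[OF that] that
    by (auto simp: u_def field_simps mult_nonneg_nonpos)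
  have decr: "\<exists>y. ((\<lambda>x. u x + d / 2 * ln x) has_real_derivative y) (at x) \<and> y \<le> 0" if "X \<le> x" for x
  proof -
    have x: "0 < x" using that X by simp
    have hx: "h x > 0" by (rule pos[OF x])
    define v where "v = (h' x + x * h'' x) / h x - x * (h' x)\<^sup>2 / (h x)\<^sup>2 + d / 2 / x"
    have "((\<lambda>x. u x + d / 2 * ln x) has_real_derivative v) (at x)"
      unfolding u_def v_def using x hx
      by (auto intro!: derivative_eq_intros h h' simp: field_simps power2_eq_square)
    moreover have "v \<le> 0"
    proof -
      define Q where "Q = (u x)\<^sup>2 + s * u x + p"
      define R where "R = ((s + 1 - c) * u x + p) / (1 + x)"
      define w where "w = x\<^sup>2 * h'' x / h x"
      have "(1 + x) * w + ((c + (s + 1) * x) * u x + p * x) =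
          x / h x * (x * (1 + x) * h'' x + (c + (s + 1) * x) * h' x + p * h x)"
        using hx by (simp add: u_def w_def field_simps power2_eq_square)
      then have "(1 + x) * w = - ((c + (s + 1) * x) * u x + p * x)"
        using ode[OF x] by simp
      \<comment> \<open>Dividing by \<open>1 + x\<close> splits the equation into its limit at
        infinity and an error of order \<open>1 / x\<close>.\<close>
      then have w: "w = - (s + 1) * u x - p + ((s + 1 - c) * u x + p) / (1 + x)"
        using x by (simp add: field_simps)
      have "x * v = u x + w - (u x)\<^sup>2 + d / 2"
        unfolding v_def u_def w_def using x hx by (simp add: field_simps power2_eq_square)
      also have "\<dots> = - Q + R + d / 2"
        unfolding w Q_def R_def by (simp add: algebra_simps)
      finally have "x * v = - Q + R + d / 2" .
      moreover have "Q \<ge> d"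
        using zero_le_power2[of "u x + s / 2"] by (simp add: Q_def d_def power2_eq_square algebra_simps)
      moreover have "R \<le> d / 2"
      proof -
        have "\<bar>(s + 1 - c) * u x\<bar> \<le> \<bar>s + 1 - c\<bar> * 1"
          unfolding abs_mult using u[OF x] by (intro mult_left_mono) auto
        then have "(s + 1 - c) * u x + p \<le> K"
          by (simp add: K_def)
        also have "K \<le> d / 2 * (1 + x)"
          using that d by (simp add: X_def field_simps)
        finally show ?thesis using x by (simp add: R_def field_simps)
      qed
      ultimately have "x * v \<le> 0" by linarith
      then show ?thesis using x by (simp add: mult_le_0_iff)
    qed
    ultimately show ?thesis by blast
  qed
  \<comment> \<open>From \<open>X\<close> to \<open>Y\<close> the term \<open>d / 2 * ln x\<close>
    grows by exactly 2, so \<open>u\<close> would drop by at least 2, more than the length of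
    [-1,0].\<close>
  define Y where "Y = X * exp (4 / d)"
  have Y: "Y \<ge> X" using X d by (simp add: Y_def)
  have "u X + d / 2 * ln X \<ge> u Y + d / 2 * ln Y"
    by (rule DERIV_nonpos_imp_nonincreasing[OF Y]) (use decr in auto)
  moreover have "d / 2 * ln Y = d / 2 * ln X + 2"
    using X d by (simp add: Y_def ln_mult field_simps)
  ultimately show False
    using u[of X] u[of Y] X Y by linarith
qed

section \<open>Restriction to the negative axis when the lower parameter is real\<close>

lemma neg_in_slit_plane: "0 < x \<Longrightarrow> - complex_of_real x \<in> slit_plane"
  unfolding slit_plane_def
  by (auto simp flip: of_real_minus)

lemma has_real_derivative_Re_neg:
  assumes "(f has_field_derivative D) (at (- complex_of_real x))"
  shows "((\<lambda>x. Re (f (- of_real x))) has_real_derivative - Re D) (at x)"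
proof -
  have "((\<lambda>x. f (- of_real x)) has_vector_derivative (- 1) * D) (at x)"
    by (rule field_vector_diff_chain_at[where f = "\<lambda>x. - complex_of_real x", unfolded o_def])
       (use assms in \<open>auto intro!: derivative_eq_intros\<close>)
  from bounded_linear.has_vector_derivative[OF bounded_linear_Re this] show ?thesis
    by (simp add: has_real_derivative_iff_has_vector_derivative)
qed

lemma hyp2F1_class_T_real_parameters:
  assumes c: "c \<notin> \<int>\<^sub>\<le>\<^sub>0" and F: "is_hyp2F1 a b c F" "F \<in> class_T"
    and real: "c \<in> \<real>" "a + b \<in> \<real>" "a * b \<in> \<real>"
  shows "a \<in> \<real>"
proof (rule ccontr)
  assume "a \<notin> \<real>"
  obtain \<mu> where \<mu>: "stieltjes_prob \<mu>"
    and int: "\<And>z. z \<in> slit_plane \<Longrightarrow> F z = (LINT t|\<mu>. 1 / (1 - complex_of_real t * z))"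
    using class_TE[OF F(2)] by blast
  interpret stieltjes_prob \<mu> by (rule \<mu>)
  \<comment> \<open>Each differentiation of \<open>F (- x)\<close> in \<open>x\<close> contributes a
    sign, hence the minus in \<open>h'\<close> and none in \<open>h''\<close>.\<close>
  define h h' h'' where "h x = Re (F (- of_real x))" "h' x = - Re (deriv F (- of_real x))"
    "h'' x = Re (deriv (deriv F) (- of_real x))" for x
  have hol: "F holomorphic_on slit_plane" "deriv F holomorphic_on slit_plane"
    using F(1) by (auto simp: is_hyp2F1_def analytic_imp_holomorphic intro!: holomorphic_deriv open_slit_plane)
  have h: "(h has_real_derivative h' x) (at x)" if "0 < x" for x
    unfolding h_h'_h''_def
    by (intro has_real_derivative_Re_neg holomorphic_derivI[OF hol(1) open_slit_plane] neg_in_slit_plane that)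
  have h': "(h' has_real_derivative h'' x) (at x)" if "0 < x" for x
    using DERIV_minus[OF has_real_derivative_Re_neg[OF
        holomorphic_derivI[OF hol(2) open_slit_plane neg_in_slit_plane[OF that]]]]
    unfolding h_h'_h''_def by simp
  have h_eq: "h x = stieltjes x" if "0 < x" for x
    using int[OF neg_in_slit_plane[OF that]] LINT_eq_stieltjes[of x] by (simp add: h_h'_h''_def)
  have ode: "x * (1 + x) * h'' x + (Re c + (Re (a + b) + 1) * x) * h' x + Re (a * b) * h x = 0"
    if "0 < x" for x
  proof -
    obtain c' s p where eq: "c = of_real c'" "a + b = of_real s" "a * b = of_real p"
      using real by (auto elim!: Reals_cases)
    have "Re (- of_real x * (1 - - of_real x) * deriv (deriv F) (- of_real x)
        + (c - (a + b + 1) * - of_real x) * deriv F (- of_real x) - a * b * F (- of_real x)) = 0"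
      using hypergeometric_ode[OF c F(1) neg_in_slit_plane[OF that]] by simp
    then show ?thesis
      unfolding eq h_h'_h''_def by (simp add: algebra_simps)
  qed
  have nonpos: "h' x \<le> 0" if "0 < x" for x
  proof -
    have "mono_on {0<..} (\<lambda>x. - h x)"
      by (auto intro!: mono_onI simp: h_eq stieltjes_antimono)
    from mono_on_imp_deriv_nonneg[OF this DERIV_minus[OF h[OF that]]] that show ?thesis
      by (simp add: interior_open)
  qed
  have lower: "- h x \<le> x * h' x" if "0 < x" for x
  proof -
    have "mono_on {0<..} (\<lambda>x. x * h x)"
      by (auto intro!: mono_onI simp: h_eq mult_stieltjes_mono)
    from mono_on_imp_deriv_nonneg[OF this DERIV_mult[OF DERIV_ident h[OF that]]] that show ?thesis
      by (simp add: interior_open mult.commute)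
  qed
  show False
    by (rule hypergeometric_ode_oscillates[OF h h' ode conjugate_pair_discriminant _ nonpos lower])
       (use real \<open>a \<notin> \<real>\<close> in \<open>auto simp: h_eq stieltjes_pos\<close>)
qed

theorem theorem3p2:
  fixes a b c :: complex and F :: "complex \<Rightarrow> complex"
  assumes "c \<notin> \<int>\<^sub>\<le>\<^sub>0"
    and "is_hyp2F1 a b c F"
    and "F \<in> class_T"
  shows "(a \<in> \<real> \<and> b \<in> \<real> \<and> c \<in> \<real>) \<or>
    (\<exists>k::real. 0 \<le> k \<and> k \<le> 1 \<and>
       (\<forall>z\<in>slit_plane. F z = (1 - z) powr (- complex_of_real k)))"
proof -
  obtain \<mu> where \<mu>: "stieltjes_prob \<mu>"
    and int: "\<And>z. z \<in> slit_plane \<Longrightarrow> F z = (LINT t|\<mu>. 1 / (1 - complex_of_real t * z))"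
    using class_TE[OF assms(3)] by blast
  interpret stieltjes_prob \<mu> by (rule \<mu>)
  have "hyp_coeff a b c = (\<lambda>n. of_real (moment n))"
  proof (rule fps_expansion_sums_unique)
    fix z :: complex assume z: "norm z < 1"
    then have "z \<in> slit_plane"
      using ball_subset_slit_plane by auto
    then show "(\<lambda>n. of_real (moment n) * z ^ n) sums F z"
      using moment_sums[OF z] int by simp
    show "(\<lambda>n. hyp_coeff a b c n * z ^ n) sums F z"
      using assms(2) z by (simp add: is_hyp2F1_def hyp_coeff_def)
  qed
  then have coeff: "hyp_coeff a b c n = of_real (moment n)" for n
    by (rule fun_cong)
  \<comment> \<open>The coefficient of index 1 for parameters \<open>d\<close>, \<open>c\<close>,
    \<open>c\<close> is \<open>d\<close> itself, so the exponent is the first moment, which lies in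
    [0,1].\<close>
  have powr: ?thesis if "is_hyp2F1 d c c F" "hyp_coeff a b c = hyp_coeff d c c" for d
  proof -
    have "c \<noteq> 0"
      using assms(1) by auto
    then have "d = of_real (moment 1)"
      using that(2) coeff[of 1] by (simp add: hyp_coeff_def)
    then have "\<forall>z\<in>slit_plane. F z = (1 - z) powr (- complex_of_real (moment 1))"
      using is_hyp2F1_unique[OF that(1) is_hyp2F1_powr[OF assms(1)]] by auto
    then show ?thesis
      using moment_nonneg moment_le_1 by blast
  qed
  show ?thesis
  proof (cases "\<exists>n. moment n = 0")
    case True
    then have AE_0: "AE t in \<mu>. t = 0"
      using moment_eq_0_imp_AE by blast
    have "F z = (1 - z) powr (- complex_of_real 0)" if z: "z \<in> slit_plane" for z
    proof -
      have "F z = (LINT t|\<mu>. 1)"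
        unfolding int[OF z]
      proof (rule integral_cong_AE)
        show "(\<lambda>t. 1 / (1 - complex_of_real t * z)) \<in> borel_measurable \<mu>"
          by (intro borel_measurable_continuous_on continuous_intros)
             (use slit_plane_denominator_nonzero[OF z] in auto)
        show "AE t in \<mu>. 1 / (1 - complex_of_real t * z) = 1"
          using AE_0 by eventually_elim simp
      qed simp
      \<comment> \<open>\<open>0 powr 0\<close> is 0 by convention, so the base \<open>1 - z\<close>
        has to be nonzero.\<close>
      moreover have "z \<noteq> 1"
        using z by (auto simp: slit_plane_def)
      ultimately show ?thesis
        by (simp add: prob_space)
    qed
    then show ?thesis
      by (intro disjI2 exI[of _ 0]) auto
  next
    case False
    have "(a + of_nat n) * (b + of_nat n) * (cnj c + of_nat n) \<in> \<real>" for n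
      using False by (intro hyp_coeff_real_imp[OF assms(1)]) (auto simp: coeff)
    note cubic = cubic_real_imp_coeffs_real[OF this]
    show ?thesis
    proof (cases "c \<in> \<real>")
      case True
      then have "cnj c = c" by (simp add: Reals_cnj_iff)
      then have sum: "a + b \<in> \<real>"
        using Reals_diff[OF cubic(1) True] by simp
      have "a * b \<in> \<real>"
        using Reals_diff[OF cubic(2) Reals_mult[OF sum True]] \<open>cnj c = c\<close> by (simp add: algebra_simps)
      then have "a \<in> \<real>"
        using hyp2F1_class_T_real_parameters[OF assms True sum] by blast
      then show ?thesis
        using Reals_diff[OF sum] True by force
    next
      case False
      then consider "c = a" | "c = b"
        using real_cubic_nonreal_root[OF cubic] by blast
      then show ?thesis
      proof cases
        case 1
        show ?thesis
          by (rule powr[of b]) (use assms(2) 1 in \<open>auto simp: is_hyp2F1_commute hyp_coeff_def fun_eq_iff\<close>)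
      next
        case 2
        show ?thesis
          by (rule powr[of a]) (use assms(2) 2 in auto)
      qed
    qed
  qed
qed

end
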